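(* Let $\tfrac{3}{16}<\delta<\tfrac12$ and let \[ q=1-2\delta-\frac{1}{\left\lceil \frac{2}{1-2\delta}\right\rceil}. \] Then no deterministic online algorithm for the Online Simple Knapsack problem with item size estimates and additive estimate accuracy $\delta$ has competitive ratio smaller than $\frac1q$.
   Context: Online Simple Knapsack with Item Size Estimates (additive accuracy $\delta\ge 0$): an instance consists of actual item sizes $x_1,\dots,x_n\in[0,1]$ together with estimated sizes $x_1',\dots,x_n'$ satisfying $x_i'-\delta\le x_i\le x_i'+\delta$ for all $i$. A deterministic online algorithm knows $\delta$ and the whole list of estimates $x_1',\dots,x_n'$ from the start. The actual sizes are then revealed one at a time in order. When $x_i$ is revealed, the algorithm must irrevocably either pack it into an initially empty knapsack of capacity $1$ (allowed only if the total size already packed plus $x_i$ is at most $1$) or reject it. The gain of an algorithm is the total size of the packed items. The optimal gain $\mathrm{OPT}$ of an instance is the maximum total size of a subset of the actual items with total size at most $1$. The competitive ratio of an algorithm $A$ is $\sup \mathrm{OPT}/\mathrm{gain}_A$, the supremum over all instances with accuracy $\delta$. *)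

theory Defs
  imports Complex_Main "HOL-Library.Extended_Nonnegative_Real"
begin

definition knapsack_instance :: "real \<Rightarrow> real list \<Rightarrow> real list \<Rightarrow> bool" where
  "knapsack_instance \<delta> est xs \<longleftrightarrow>
     length est = length xs \<and>
     (\<forall>i<length xs. 0 \<le> xs ! i \<and> xs ! i \<le> 1 \<and>
        est ! i - \<delta> \<le> xs ! i \<and> xs ! i \<le> est ! i + \<delta>)"

(* A strategy maps the accuracy, the full list of estimates and the actual sizes revealed
   so far (the current item being the last entry) to the decision whether to pack the
   current item. Its own earlier decisions are determined by these data. *)
type_synonym strategy = "real \<Rightarrow> real list \<Rightarrow> real list \<Rightarrow> bool"

definition packed :: "strategy \<Rightarrow> real \<Rightarrow> real list \<Rightarrow> real list \<Rightarrow> nat set" where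
  "packed A \<delta> est xs = {i. i < length xs \<and> A \<delta> est (take (Suc i) xs)}"

definition gain :: "strategy \<Rightarrow> real \<Rightarrow> real list \<Rightarrow> real list \<Rightarrow> real" where
  "gain A \<delta> est xs = (\<Sum>i\<in>packed A \<delta> est xs. xs ! i)"

definition online_algorithm :: "real \<Rightarrow> strategy \<Rightarrow> bool" where
  "online_algorithm \<delta> A \<longleftrightarrow>
     (\<forall>est xs. knapsack_instance \<delta> est xs \<longrightarrow>
        (\<forall>i\<in>packed A \<delta> est xs.
           (\<Sum>j | j \<in> packed A \<delta> est xs \<and> j < i. xs ! j) + xs ! i \<le> 1))"

definition opt_gain :: "real list \<Rightarrow> real" where
  "opt_gain xs =
     Max {(\<Sum>i\<in>I. xs ! i) | I. I \<subseteq> {..<length xs} \<and> (\<Sum>i\<in>I. xs ! i) \<le> 1}"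

(* In ennreal, a / 0 = top for a > 0, and 0 / 0 = 0. The latter value does not influence
   the supremum: a single item of size 1 already contributes at least 1. *)
definition competitive_ratio :: "real \<Rightarrow> strategy \<Rightarrow> ennreal" where
  "competitive_ratio \<delta> A =
     (SUP (est, xs) \<in> {(est, xs). knapsack_instance \<delta> est xs}.
        ennreal (opt_gain xs) / ennreal (gain A \<delta> est xs))"

end

theory Submission imports Defs begin

text \<open>
  Write \<open>N = \<lceil>2 / (1 - 2\<delta>)\<rceil>\<close>, so that \<open>1/N \<le> q\<close> and \<open>q + 2\<delta> = 1 - 1/N\<close>. The adversary announces
  \<open>M + N\<close> items with estimate \<open>\<delta>\<close>, which may turn out to have any size in \<open>[0, 2\<delta>]\<close>, followed by one
  item with estimate \<open>q + \<delta>\<close>, whose size may be anything in \<open>[q, 1 - 1/N]\<close>. The first \<open>M\<close> items have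
  size \<open>1/M\<close> until the algorithm packs one of them; the remaining ones have size \<open>0\<close>.
  If none is packed, they fill the knapsack optimally; the other items have sizes \<open>0, \<dots>, 0, q\<close>, and the
  algorithm gains at most \<open>q\<close>. Otherwise the next \<open>N\<close> items have size \<open>1/N\<close>, again until one is packed.
  If none of these is packed, they fill the knapsack optimally, the last item has size \<open>q\<close>, and the gain
  is at most \<open>q + 1/M\<close>. If one of them is packed, the last item has size \<open>1 - 1/N\<close>: together with an item of
  size \<open>1/N\<close> it fills the knapsack, but the algorithm, having packed \<open>1/N + 1/M\<close>, has no room for it.
  Letting \<open>M\<close> tend to infinity gives the bound.
\<close>

lemma finite_packed: "finite (packed A \<delta> est xs)"
  by (simp add: packed_def)

lemma gain_Nil: "gain A \<delta> est [] = 0"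
  by (simp add: gain_def packed_def)

text \<open>Each decision sees only the prefix ending at its own item (the estimates being fixed),
  so a further item leaves the earlier decisions as they were.\<close>

lemma gain_snoc:
  "gain A \<delta> est (xs @ [x]) = gain A \<delta> est xs + (if A \<delta> est (xs @ [x]) then x else 0)"
proof -
  let ?last = "if A \<delta> est (xs @ [x]) then {length xs} else {}"
  have "packed A \<delta> est (xs @ [x]) = packed A \<delta> est xs \<union> ?last"
    by (auto simp: packed_def less_Suc_eq)
  moreover have "packed A \<delta> est xs \<inter> ?last = {}"
    by (auto simp: packed_def)
  ultimately have "gain A \<delta> est (xs @ [x])
      = (\<Sum>i\<in>packed A \<delta> est xs. (xs @ [x]) ! i) + (\<Sum>i\<in>?last. (xs @ [x]) ! i)"
    unfolding gain_def by (simp add: sum.union_disjoint finite_packed del: Un_insert_right)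
  moreover have "(\<Sum>i\<in>packed A \<delta> est xs. (xs @ [x]) ! i) = gain A \<delta> est xs"
    unfolding gain_def by (rule sum.cong) (auto simp: packed_def nth_append)
  ultimately show ?thesis
    by simp
qed

lemma gain_append_zeros: "gain A \<delta> est (xs @ replicate n 0) = gain A \<delta> est xs"
proof (induction n)
  case (Suc n)
  have "xs @ replicate (Suc n) 0 = (xs @ replicate n 0) @ [0]"
    by (simp add: replicate_append_same)
  then show ?case
    using Suc by (simp only: gain_snoc) simp
qed simp

lemma gain_le_1:
  assumes "online_algorithm \<delta> A" and "knapsack_instance \<delta> est xs"
  shows "gain A \<delta> est xs \<le> 1"
proof (cases "packed A \<delta> est xs = {}")
  case False
  let ?P = "packed A \<delta> est xs"
  \<comment> \<open>The capacity condition at the last packed item already counts every packed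
    item.\<close>
  let ?m = "Max ?P"
  have m: "?m \<in> ?P"
    using False finite_packed by (rule Max_in[rotated])
  have "{j. j \<in> ?P \<and> j < ?m} = ?P - {?m}"
    using Max_ge[OF finite_packed] by (fastforce simp: less_le)
  then have "(\<Sum>j | j \<in> ?P \<and> j < ?m. xs ! j) + xs ! ?m = gain A \<delta> est xs"
    using m by (simp add: gain_def sum.remove[OF finite_packed m] del: Max_less_iff)
  moreover have "(\<Sum>j | j \<in> ?P \<and> j < ?m. xs ! j) + xs ! ?m \<le> 1"
    using assms m unfolding online_algorithm_def by blast
  ultimately show ?thesis
    by simp
qed (simp add: gain_def)

lemma opt_gain_ge:
  assumes "I \<subseteq> {..<length xs}" and "(\<Sum>i\<in>I. xs ! i) \<le> 1"
  shows "(\<Sum>i\<in>I. xs ! i) \<le> opt_gain xs"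
proof -
  have "{(\<Sum>i\<in>I. xs ! i) | I. I \<subseteq> {..<length xs} \<and> (\<Sum>i\<in>I. xs ! i) \<le> 1}
      \<subseteq> (\<lambda>I. \<Sum>i\<in>I. xs ! i) ` Pow {..<length xs}"
    by auto
  then have "finite {(\<Sum>i\<in>I. xs ! i) | I. I \<subseteq> {..<length xs} \<and> (\<Sum>i\<in>I. xs ! i) \<le> 1}"
    by (rule finite_subset) simp
  then show ?thesis
    unfolding opt_gain_def using assms by (intro Max_ge) auto
qed

lemma opt_gain_ge_1_of_block:
  assumes "n > 0"
  shows "opt_gain (xs @ replicate n (1 / real n) @ ys) \<ge> 1"
proof -
  let ?zs = "xs @ replicate n (1 / real n) @ ys"
  have "(\<Sum>i\<in>{length xs..<length xs + n}. ?zs ! i) = (\<Sum>i\<in>{length xs..<length xs + n}. 1 / real n)"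
    by (rule sum.cong) (auto simp: nth_append)
  also have "\<dots> = 1"
    using assms by simp
  finally have sum: "(\<Sum>i\<in>{length xs..<length xs + n}. ?zs ! i) = 1" .
  have "{length xs..<length xs + n} \<subseteq> {..<length ?zs}"
    by auto
  from opt_gain_ge[OF this] sum show ?thesis
    by simp
qed

lemma opt_gain_ge_1_of_pair:
  assumes "x \<in> set xs" and "x + y = 1"
  shows "opt_gain (xs @ [y]) \<ge> 1"
proof -
  obtain i where i: "i < length xs" "xs ! i = x"
    using assms(1) by (auto simp: in_set_conv_nth)
  then have sum: "(\<Sum>j\<in>{i, length xs}. (xs @ [y]) ! j) = 1"
    using assms(2) by (simp add: nth_append)
  have "{i, length xs} \<subseteq> {..<length (xs @ [y])}"
    using i by auto
  from opt_gain_ge[OF this] sum show ?thesis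
    by simp
qed

text \<open>The block repeats \<open>s\<close> until it is packed for the first time and then
  continues with zeros, which leave the gain unchanged whether packed or not. As decisions depend on
  the history, \<open>xs\<close> varies in the induction.\<close>

lemma exists_probing_block:
  "\<exists>ys. length ys = n \<and> set ys \<subseteq> {0, s} \<and>
     (ys = replicate n s \<and> gain A \<delta> est (xs @ ys) = gain A \<delta> est xs \<or>
      s \<in> set ys \<and> gain A \<delta> est (xs @ ys) = gain A \<delta> est xs + s)"
proof (induction n arbitrary: xs)
  case 0
  show ?case
    by simp
next
  case (Suc n)
  show ?case
  proof (cases "A \<delta> est (xs @ [s])")
    case True
    then have "gain A \<delta> est (xs @ s # replicate n 0) = gain A \<delta> est xs + s"
      using gain_append_zeros[of A \<delta> est "xs @ [s]" n] by (simp add: gain_snoc)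
    then show ?thesis
      by (intro exI[of _ "s # replicate n 0"]) auto
  next
    case False
    then have "gain A \<delta> est (xs @ [s]) = gain A \<delta> est xs"
      by (simp add: gain_snoc)
    with Suc[of "xs @ [s]"] obtain ys where
      "length ys = n" "set ys \<subseteq> {0, s}"
      "ys = replicate n s \<and> gain A \<delta> est (xs @ s # ys) = gain A \<delta> est xs \<or>
       s \<in> set ys \<and> gain A \<delta> est (xs @ s # ys) = gain A \<delta> est xs + s"
      by auto
    then show ?thesis
      by (intro exI[of _ "s # ys"]) auto
  qed
qed

lemma exists_hard_instance:
  fixes \<delta> q :: real and M N :: nat
  assumes A: "online_algorithm \<delta> A"
    and M: "M > 0" "1 / real M \<le> 2 * \<delta>"
    and N: "N > 0" "1 / real N \<le> 2 * \<delta>" "1 / real N \<le> q"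
    and q: "q + 2 * \<delta> = 1 - 1 / real N"
  shows "\<exists>est xs. knapsack_instance \<delta> est xs \<and> opt_gain xs \<ge> 1 \<and>
           gain A \<delta> est xs \<le> q + 1 / real M"
proof -
  define est where "est = replicate (M + N) \<delta> @ [q + \<delta>]"
  let ?\<epsilon> = "1 / real M"
  let ?s = "1 / real N"
  let ?gain = "gain A \<delta> est"
  have \<epsilon>: "?\<epsilon> > 0" and s: "?s > 0"
    using M N by auto
  have q_le: "q \<le> 1 - ?s"
    using s N q by linarith
  \<comment> \<open>One check serves all three endings: the last item has the interval
    [q, q + 2 * \<delta>] around its estimate, and its upper end is \<open>1 - ?s\<close>.\<close>
  have inst: "knapsack_instance \<delta> est (ys @ [z])"
    if "length ys = M + N" "set ys \<subseteq> {0, ?\<epsilon>, ?s}" "q \<le> z" "z \<le> 1 - ?s" for ys z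
  proof -
    have "0 \<le> y \<and> y \<le> 1 \<and> y \<le> 2 * \<delta>" if "y \<in> set ys" for y
    proof -
      have "y \<in> {0, ?\<epsilon>, ?s}"
        using that \<open>set ys \<subseteq> _\<close> by blast
      then have "0 \<le> y \<and> y \<le> 2 * \<delta>"
        using \<epsilon> s M N by (elim insertE emptyE) linarith+
      moreover have "2 * \<delta> \<le> 1"
        using s N q by linarith
      ultimately show ?thesis
        by linarith
    qed
    then have "0 \<le> ys ! i \<and> ys ! i \<le> 1 \<and> ys ! i \<le> 2 * \<delta>" if "i < length ys" for i
      using that nth_mem by blast
    moreover have "0 \<le> z \<and> z \<le> 1 \<and> z \<le> q + \<delta> + \<delta>"
      using that s N q by linarith
    ultimately show ?thesis
      using that
      unfolding knapsack_instance_def est_def by (auto simp: nth_append less_Suc_eq)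
  qed
  have final: "?gain (ys @ [q]) \<le> ?gain ys + q" for ys
    using order_trans[OF less_imp_le[OF s] N(3)] by (simp add: gain_snoc)
  from exists_probing_block[of M ?\<epsilon> A \<delta> est "[]"] obtain ys where
    ys: "length ys = M" "set ys \<subseteq> {0, ?\<epsilon>}" and
    ys_cases: "ys = replicate M ?\<epsilon> \<and> ?gain ys = 0 \<or> ?gain ys = ?\<epsilon>"
    by (auto simp: gain_Nil)
  from ys_cases show ?thesis
  proof
    assume *: "ys = replicate M ?\<epsilon> \<and> ?gain ys = 0"
    let ?xs = "(ys @ replicate N 0) @ [q]"
    have "knapsack_instance \<delta> est ?xs"
      by (rule inst) (use ys q_le in auto)
    moreover have "opt_gain ?xs \<ge> 1"
      using * opt_gain_ge_1_of_block[OF M(1), of "[]" "replicate N 0 @ [q]"] by simp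
    moreover have "?gain ?xs \<le> q + ?\<epsilon>"
      using conjunct2[OF *] \<epsilon> final[of "ys @ replicate N 0"]
      unfolding gain_append_zeros by linarith
    ultimately show ?thesis
      by blast
  next
    assume *: "?gain ys = ?\<epsilon>"
    from exists_probing_block[of N ?s A \<delta> est ys] obtain zs where
      zs: "length zs = N" "set zs \<subseteq> {0, ?s}" and
      zs_cases: "zs = replicate N ?s \<and> ?gain (ys @ zs) = ?\<epsilon> \<or>
        ?s \<in> set zs \<and> ?gain (ys @ zs) = ?\<epsilon> + ?s"
      using * by auto
    from zs_cases show ?thesis
    proof
      assume **: "zs = replicate N ?s \<and> ?gain (ys @ zs) = ?\<epsilon>"
      let ?xs = "(ys @ zs) @ [q]"
      have "knapsack_instance \<delta> est ?xs"
        by (rule inst) (use ys zs q_le in auto)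
      moreover have "opt_gain ?xs \<ge> 1"
        using ** opt_gain_ge_1_of_block[OF N(1), of ys "[q]"] by simp
      moreover have "?gain ?xs \<le> q + ?\<epsilon>"
        using conjunct2[OF **] final[of "ys @ zs"] by linarith
      ultimately show ?thesis
        by blast
    next
      assume **: "?s \<in> set zs \<and> ?gain (ys @ zs) = ?\<epsilon> + ?s"
      let ?xs = "(ys @ zs) @ [1 - ?s]"
      have inst': "knapsack_instance \<delta> est ?xs"
        by (rule inst) (use ys zs q_le in auto)
      moreover have "opt_gain ?xs \<ge> 1"
        using ** by (intro opt_gain_ge_1_of_pair[of ?s]) auto
      \<comment> \<open>Packing the last item would raise the gain to
        \<open>1 + ?\<epsilon>\<close>, beyond the capacity. So it is rejected, and
        \<open>?\<epsilon> + ?s\<close> remains, where \<open>?s \<le> q\<close>.\<close>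
      moreover have "?gain ?xs \<le> q + ?\<epsilon>"
        using gain_le_1[OF A inst'] conjunct2[OF **] \<epsilon> N(3) unfolding gain_snoc by (auto split: if_splits)
      ultimately show ?thesis
        by blast
    qed
  qed
qed

lemma competitive_ratio_ge:
  assumes inst: "knapsack_instance \<delta> est xs"
    and opt: "opt_gain xs \<ge> 1" and gain: "gain A \<delta> est xs \<le> c"
  shows "competitive_ratio \<delta> A \<ge> ennreal (1 / c)"
proof -
  let ?g = "gain A \<delta> est xs"
  have "ennreal (1 / c) \<le> ennreal (opt_gain xs) / ennreal ?g"
  proof (cases "?g > 0")
    case True
    then have "1 / c \<le> opt_gain xs / ?g"
      using opt gain by (intro frac_le) auto
    then show ?thesis
      using True opt by (simp add: divide_ennreal ennreal_leI)
  next
    \<comment> \<open>A gain that is not positive becomes 0 in \<open>ennreal\<close>, so the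
      quotient is \<open>top\<close>.\<close>
    case False
    then show ?thesis
      using opt by (simp add: ennreal_neg)
  qed
  also have "\<dots> \<le> competitive_ratio \<delta> A"
    unfolding competitive_ratio_def using inst
    by (intro SUP_upper2[of "(est, xs)"]) auto
  finally show ?thesis .
qed

theorem theorem5:
  fixes \<delta> q :: real
  assumes "3 / 16 < \<delta>" and "\<delta> < 1 / 2"
    and "q = 1 - 2 * \<delta> - 1 / of_int \<lceil>2 / (1 - 2 * \<delta>)\<rceil>"
  shows "\<not> (\<exists>A. online_algorithm \<delta> A \<and> competitive_ratio \<delta> A < ennreal (1 / q))"
proof -
  define N where "N = nat \<lceil>2 / (1 - 2 * \<delta>)\<rceil>"
  have pos: "2 / (1 - 2 * \<delta>) > 0"
    using assms by simp
  then have N_eq: "real N = of_int \<lceil>2 / (1 - 2 * \<delta>)\<rceil>"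
    by (simp add: N_def)
  then have N_ge: "real N \<ge> 2 / (1 - 2 * \<delta>)"
    by simp
  with pos have N_pos: "N > 0"
    by (auto intro: gr0I)
  have "1 / real N \<le> 1 / (2 / (1 - 2 * \<delta>))"
    using pos N_ge by (rule frac_le[OF zero_le_one order_refl])
  then have s: "1 / real N \<le> (1 - 2 * \<delta>) / 2"
    by simp
  have q: "q + 2 * \<delta> = 1 - 1 / real N"
    using assms(3) N_eq by simp
  \<comment> \<open>Since \<open>1 / real N\<close> is at most half of 1 - 2 * \<delta>, subtracting
    it leaves at least that half, which is \<open>q\<close>. The half is below 2 * \<delta> because
    \<delta> > 3/16 > 1/6.\<close>
  have s_q: "1 / real N \<le> q" and s_\<delta>: "1 / real N \<le> 2 * \<delta>"
    using s q assms(1) by argo+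
  have q_pos: "q > 0"
    using s_q N_pos by (smt (verit) divide_pos_pos of_nat_0_less_iff)
  have "competitive_ratio \<delta> A \<ge> ennreal (1 / q)" if A: "online_algorithm \<delta> A" for A
  \<comment> \<open>The ratio of \<open>A\<close> does not depend on \<open>M\<close>, so it also
    bounds the limit of the lower bounds obtained for the individual \<open>M\<close>.\<close>
  proof (rule LIMSEQ_le_const2)
    have "(\<lambda>M. 1 / (q + 1 / real M)) \<longlonglongrightarrow> 1 / (q + 0)"
      using q_pos by (intro tendsto_intros lim_1_over_n) auto
    then show "(\<lambda>M. ennreal (1 / (q + 1 / real M))) \<longlonglongrightarrow> ennreal (1 / q)"
      by (intro tendsto_ennrealI) simp
    \<comment> \<open>From \<open>M \<ge> 3\<close> it follows that 1/M \<le> 1/3 < 3/8 < 2 *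
      \<delta>, so the size 1/M is compatible with the estimate \<delta>.\<close>
    have "ennreal (1 / (q + 1 / real M)) \<le> competitive_ratio \<delta> A" if "M \<ge> 3" for M
    proof -
      have M: "M > 0" "1 / real M \<le> 2 * \<delta>"
        using that assms(1) by (auto simp: field_simps intro: order_trans[of _ "3 * (\<delta> * 2)"])
      from exists_hard_instance[OF A M N_pos s_\<delta> s_q q] obtain est xs where
        "knapsack_instance \<delta> est xs" "opt_gain xs \<ge> 1" "gain A \<delta> est xs \<le> q + 1 / real M"
        by blast
      then show ?thesis
        using q_pos by (intro competitive_ratio_ge) (auto intro: add_pos_nonneg)
    qed
    then show "\<exists>n. \<forall>M\<ge>n. ennreal (1 / (q + 1 / real M)) \<le> competitive_ratio \<delta> A"
      by blast
  qed
  then show ?thesis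
    by (auto simp: not_less)
qed

end
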